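(* For each $i\in\{1,2\}$, let $X_i$ be a Banach space and let $Y_i$ be a closed non-trivial linear subspace of $X_i$. Let $X=X_1\oplus_\infty X_2$ and $Y=Y_1\oplus_\infty Y_2$. Then: (i) If $(Y,\mathcal{CB}(X))$ has the restricted center property, then $(Y_i,\mathcal{CB}(X_i))$ has the restricted center property for each $i\in\{1,2\}$. (ii) If $(X,Y,\mathcal{CB}(X))$ has property-$(P_1)$, then $(X_i,Y_i,\mathcal{CB}(X_i))$ has property-$(P_1)$ for each $i\in\{1,2\}$.
   Context: All Banach spaces are real. Non-trivial means different from $\{0\}$. $X_1\oplus_\infty X_2$ is $X_1\times X_2$ with the norm $\|(x_1,x_2)\|=\max\{\|x_1\|,\|x_2\|\}$. For a Banach space $E$, $B_E$ is its closed unit ball and $\mathcal{CB}(E)$ is the class of non-empty closed bounded subsets of $E$. For $v\in E$ and a non-empty bounded set $F\subseteq E$, $r(v,F)=\sup_{z\in F}\|v-z\|$. For a non-empty closed convex $V\subseteq E$: $\mathrm{rad}_V(F)=\inf_{v\in V}r(v,F)$, $\mathrm{cent}_V(F)=\{v\in V: r(v,F)=\mathrm{rad}_V(F)\}$, and for $\delta>0$, $\mathrm{cent}_V(F,\delta)=\{v\in V: r(v,F)\le \mathrm{rad}_V(F)+\delta\}$. For $\mathscr F\subseteq\mathcal{CB}(E)$, the pair $(V,\mathscr F)$ has the restricted center property (r.c.p.) if $\mathrm{cent}_V(F)\ne\emptyset$ for every $F\in\mathscr F$. The triplet $(E,V,\mathscr F)$ has property-$(P_1)$ if $(V,\mathscr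 F)$ has r.c.p. and for every $\varepsilon>0$ and $F\in\mathscr F$ there is $\delta>0$ with $\mathrm{cent}_V(F,\delta)\subseteq\mathrm{cent}_V(F)+\varepsilon B_E$. *)

theory Defs
  imports "HOL-Analysis.Analysis"
begin

text \<open>The library norm on \<open>'a \<times> 'b\<close> is the Euclidean one, so the direct sum with the maximum norm
  gets a type of its own.\<close>

datatype ('a, 'b) linf_sum = Linf (linf_fst: 'a) (linf_snd: 'b)

instantiation linf_sum :: (real_vector, real_vector) real_vector
begin

definition zero_linf_sum :: "('a, 'b) linf_sum"
  where "0 = Linf 0 0"

definition plus_linf_sum :: "('a, 'b) linf_sum \<Rightarrow> ('a, 'b) linf_sum \<Rightarrow> ('a, 'b) linf_sum"
  where "x + y = Linf (linf_fst x + linf_fst y) (linf_snd x + linf_snd y)"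

definition minus_linf_sum :: "('a, 'b) linf_sum \<Rightarrow> ('a, 'b) linf_sum \<Rightarrow> ('a, 'b) linf_sum"
  where "x - y = Linf (linf_fst x - linf_fst y) (linf_snd x - linf_snd y)"

definition uminus_linf_sum :: "('a, 'b) linf_sum \<Rightarrow> ('a, 'b) linf_sum"
  where "- x = Linf (- linf_fst x) (- linf_snd x)"

definition scaleR_linf_sum :: "real \<Rightarrow> ('a, 'b) linf_sum \<Rightarrow> ('a, 'b) linf_sum"
  where "c *\<^sub>R x = Linf (c *\<^sub>R linf_fst x) (c *\<^sub>R linf_snd x)"

instance
  by standard
    (simp_all add: zero_linf_sum_def plus_linf_sum_def minus_linf_sum_def uminus_linf_sum_def
      scaleR_linf_sum_def algebra_simps)

end

lemma linf_fst_simps [simp]: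
  "linf_fst 0 = 0"
  "linf_fst (x + y) = linf_fst x + linf_fst y"
  "linf_fst (x - y) = linf_fst x - linf_fst y"
  "linf_fst (- x) = - linf_fst x"
  "linf_fst (c *\<^sub>R x) = c *\<^sub>R linf_fst x"
  by (simp_all add: zero_linf_sum_def plus_linf_sum_def minus_linf_sum_def uminus_linf_sum_def
      scaleR_linf_sum_def)

lemma linf_snd_simps [simp]:
  "linf_snd 0 = 0"
  "linf_snd (x + y) = linf_snd x + linf_snd y"
  "linf_snd (x - y) = linf_snd x - linf_snd y"
  "linf_snd (- x) = - linf_snd x"
  "linf_snd (c *\<^sub>R x) = c *\<^sub>R linf_snd x"
  by (simp_all add: zero_linf_sum_def plus_linf_sum_def minus_linf_sum_def uminus_linf_sum_def
      scaleR_linf_sum_def)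

instantiation linf_sum :: (real_normed_vector, real_normed_vector) real_normed_vector
begin

definition norm_linf_sum_def:
  "norm x = max (norm (linf_fst x)) (norm (linf_snd x))" for x :: "('a, 'b) linf_sum"

definition dist_linf_sum_def:
  "dist x y = norm (x - y)" for x y :: "('a, 'b) linf_sum"

definition sgn_linf_sum_def:
  "sgn x = x /\<^sub>R norm x" for x :: "('a, 'b) linf_sum"

definition uniformity_linf_sum_def:
  "(uniformity :: (('a, 'b) linf_sum \<times> ('a, 'b) linf_sum) filter) =
    (INF e\<in>{0 <..}. principal {(x, y). dist x y < e})"

definition open_linf_sum_def:
  "open U \<longleftrightarrow> (\<forall>x\<in>U. eventually (\<lambda>(x', y). x' = x \<longrightarrow> y \<in> U) uniformity)"
  for U :: "('a, 'b) linf_sum set"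

instance
proof
  fix x y :: "('a, 'b) linf_sum" and c :: real
  show "norm x = 0 \<longleftrightarrow> x = 0"
    by (cases x) (auto simp: norm_linf_sum_def zero_linf_sum_def max_def)
  show "norm (x + y) \<le> norm x + norm y"
    using norm_triangle_ineq[of "linf_fst x" "linf_fst y"]
      norm_triangle_ineq[of "linf_snd x" "linf_snd y"]
    by (auto simp: norm_linf_sum_def)
  show "norm (c *\<^sub>R x) = \<bar>c\<bar> * norm x"
    by (simp add: norm_linf_sum_def max_mult_distrib_left)
qed (rule dist_linf_sum_def sgn_linf_sum_def uniformity_linf_sum_def open_linf_sum_def)+

end

instance linf_sum :: (banach, banach) banach
proof
  fix S :: "nat \<Rightarrow> ('a, 'b) linf_sum"
  assume S: "Cauchy S"
  have le: "dist (linf_fst x) (linf_fst y) \<le> dist x y" "dist (linf_snd x) (linf_snd y) \<le> dist x y"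
    for x y :: "('a, 'b) linf_sum"
    by (simp_all add: dist_norm norm_linf_sum_def)
  have "Cauchy (\<lambda>n. linf_fst (S n))"
    by (rule metric_CauchyI) (meson S le(1) le_less_trans metric_CauchyD)
  then obtain a where a: "(\<lambda>n. linf_fst (S n)) \<longlonglongrightarrow> a"
    using Cauchy_convergent convergent_def by blast
  have "Cauchy (\<lambda>n. linf_snd (S n))"
    by (rule metric_CauchyI) (meson S le(2) le_less_trans metric_CauchyD)
  then obtain b where b: "(\<lambda>n. linf_snd (S n)) \<longlonglongrightarrow> b"
    using Cauchy_convergent convergent_def by blast
  have "(\<lambda>n. max (norm (linf_fst (S n) - a)) (norm (linf_snd (S n) - b))) \<longlonglongrightarrow> max 0 0"
    using a b by (intro tendsto_max tendsto_norm_zero LIM_zero)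
  then have "(\<lambda>n. norm (S n - Linf a b)) \<longlonglongrightarrow> 0"
    by (simp add: norm_linf_sum_def)
  then have "(\<lambda>n. S n - Linf a b) \<longlonglongrightarrow> 0"
    by (rule tendsto_norm_zero_cancel)
  then show "convergent S"
    unfolding convergent_def using LIM_zero_cancel by blast
qed

definition linf_Times :: "'a set \<Rightarrow> 'b set \<Rightarrow> ('a, 'b) linf_sum set"
  where "linf_Times A B = {z. linf_fst z \<in> A \<and> linf_snd z \<in> B}"

text \<open>In the following the ambient space \<open>E\<close> is the universe of the type \<open>'a\<close>. The real-valued
  suprema and infima are meaningful only for non-empty bounded \<open>F\<close> and non-empty \<open>V\<close>.\<close>

definition CB :: "'a::real_normed_vector set set"
  where "CB = {F. F \<noteq> {} \<and> closed F \<and> bounded F}"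

definition radius_at :: "'a::real_normed_vector \<Rightarrow> 'a set \<Rightarrow> real"
  where "radius_at v F = (SUP z\<in>F. norm (v - z))"

definition rad :: "'a::real_normed_vector set \<Rightarrow> 'a set \<Rightarrow> real"
  where "rad V F = (INF v\<in>V. radius_at v F)"

definition cent :: "'a::real_normed_vector set \<Rightarrow> 'a set \<Rightarrow> 'a set"
  where "cent V F = {v \<in> V. radius_at v F = rad V F}"

definition near_cent :: "'a::real_normed_vector set \<Rightarrow> 'a set \<Rightarrow> real \<Rightarrow> 'a set"
  where "near_cent V F \<delta> = {v \<in> V. radius_at v F \<le> rad V F + \<delta>}"

definition restricted_center_property ::
    "'a::real_normed_vector set \<Rightarrow> 'a set set \<Rightarrow> bool"
  where "restricted_center_property V \<F> \<longleftrightarrow> (\<forall>F\<in>\<F>. cent V F \<noteq> {})"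

definition property_P1 :: "'a::real_normed_vector set \<Rightarrow> 'a set set \<Rightarrow> bool"
  where "property_P1 V \<F> \<longleftrightarrow>
    restricted_center_property V \<F> \<and>
    (\<forall>\<epsilon>>0. \<forall>F\<in>\<F>. \<exists>\<delta>>0.
      near_cent V F \<delta> \<subseteq> {c + \<epsilon> *\<^sub>R b |c b. c \<in> cent V F \<and> b \<in> cball 0 1})"

end

theory Submission
  imports Defs
begin

text \<open>If \<open>i\<close> embeds one space isometrically into another and \<open>p\<close> is a norm-one left inverse of
  \<open>i\<close>, with \<open>i\<close> and \<open>p\<close> respecting the subspaces, then \<open>F\<close> and \<open>i ` F\<close> have the same restricted
  radius, \<open>p\<close> maps centers of \<open>i ` F\<close> to centers of \<open>F\<close>, and \<open>i\<close> maps near-centers of \<open>F\<close> to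
  near-centers of \<open>i ` F\<close>. So both properties descend along \<open>p\<close>. In the direct sum this applies
  to each coordinate: \<open>F\<^sub>1 \<in> CB(X\<^sub>1)\<close> is replaced by \<open>F\<^sub>1 \<times> {0}\<close>.\<close>

lemma bdd_above_norm_diff:
  fixes v :: "'a::real_normed_vector"
  assumes "bounded F"
  shows "bdd_above ((\<lambda>z. norm (v - z)) ` F)"
proof -
  obtain B where B: "\<And>z. z \<in> F \<Longrightarrow> norm z \<le> B"
    using assms bounded_iff by blast
  have "norm (v - z) \<le> norm v + B" if "z \<in> F" for z
    using norm_triangle_ineq4[of v z] B[OF that] by linarith
  then show ?thesis
    by (rule bdd_aboveI2)
qed

lemma norm_diff_le_radius_at: "bounded F \<Longrightarrow> z \<in> F \<Longrightarrow> norm (v - z) \<le> radius_at v F"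
  unfolding radius_at_def by (rule cSUP_upper[OF _ bdd_above_norm_diff])

lemma radius_at_nonneg:
  assumes "bounded F" "F \<noteq> {}"
  shows "0 \<le> radius_at v F"
  by (metis assms all_not_in_conv norm_diff_le_radius_at norm_ge_zero order_trans)

lemma rad_le_radius_at:
  assumes "bounded F" "F \<noteq> {}" "v \<in> V"
  shows "rad V F \<le> radius_at v F"
  unfolding rad_def
  \<comment> \<open>An infimum of reals is a lower bound only for a family bounded below; here 0
    bounds all the radii.\<close>
  by (rule cINF_lower[OF bdd_belowI2]) (use assms radius_at_nonneg in auto)

locale norm_one_retract =
  fixes i :: "'a::real_normed_vector \<Rightarrow> 'c::real_normed_vector"
    and p :: "'c \<Rightarrow> 'a"
    and V :: "'a set" and W :: "'c set"
  assumes linear_i: "linear i" and linear_p: "linear p"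
    and norm_i: "norm (i x) = norm x" and norm_p: "norm (p z) \<le> norm z"
    and p_i [simp]: "p (i x) = x"
    and i_mem: "x \<in> V \<Longrightarrow> i x \<in> W" and p_mem: "z \<in> W \<Longrightarrow> p z \<in> V"
    and V_nonempty: "V \<noteq> {}"
begin

lemma norm_p_diff_le: "norm (p z - p w) \<le> norm (z - w)"
  by (metis linear_diff linear_p norm_p)

lemma radius_at_embed: "radius_at (i v) (i ` F) = radius_at v F"
  by (simp add: radius_at_def image_image norm_i flip: linear_diff[OF linear_i])

lemma embed_CB:
  assumes "F \<in> CB"
  shows "i ` F \<in> CB"
proof -
  have bl_i: "bounded_linear i"
    using linear_i norm_i by (intro bounded_linear_intro[of i 1])
      (auto simp: linear_add linear_scale)
  have bl_p: "bounded_linear p"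
    using linear_p norm_p by (intro bounded_linear_intro[of p 1])
      (auto simp: linear_add linear_scale)
  \<comment> \<open>The fixed points of \<open>i \<circ> p\<close> form the range of
    \<open>i\<close>, so the image of \<open>F\<close> is cut out by two closed conditions.\<close>
  have "i ` F = p -` F \<inter> {z. i (p z) = z}"
    by force
  moreover have "closed (p -` F)"
    using assms bl_p by (intro continuous_closed_vimage)
      (auto simp: CB_def linear_continuous_at)
  moreover have "closed {z. i (p z) = z}"
    by (intro closed_Collect_eq continuous_on_id linear_continuous_on
        bounded_linear_compose[OF bl_i bl_p])
  ultimately have "closed (i ` F)"
    by (simp add: closed_Int)
  moreover have "bounded (i ` F)"
    using assms by (intro bounded_linear_image[OF _ bl_i]) (simp add: CB_def)
  ultimately show ?thesis
    using assms by (simp add: CB_def)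
qed

text \<open>Since \<open>p (i z) = z\<close>, the vector \<open>p w - z\<close> is the image under
  \<open>p\<close> of \<open>w - i z\<close>, and \<open>p\<close> does not increase norms.\<close>

lemma radius_at_retract_le:
  assumes "F \<in> CB"
  shows "radius_at (p w) F \<le> radius_at w (i ` F)"
  unfolding radius_at_def[of "p w"]
proof (rule cSUP_least)
  show "F \<noteq> {}"
    using assms by (simp add: CB_def)
  fix z assume "z \<in> F"
  then have "norm (w - i z) \<le> radius_at w (i ` F)"
    using embed_CB[OF assms] by (intro norm_diff_le_radius_at) (auto simp: CB_def)
  then show "norm (p w - z) \<le> radius_at w (i ` F)"
    using norm_p_diff_le[of w "i z"] by simp
qed

text \<open>Each competitor in one subspace yields one in the other that is no worse:
  \<open>i\<close> keeps the radius and \<open>p\<close> does not increase it.\<close>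

lemma rad_embed:
  assumes "F \<in> CB"
  shows "rad W (i ` F) = rad V F"
proof (rule antisym)
  show "rad W (i ` F) \<le> rad V F"
    unfolding rad_def[of V]
  proof (rule cINF_greatest[OF V_nonempty])
    fix v assume "v \<in> V"
    then show "rad W (i ` F) \<le> radius_at v F"
      using rad_le_radius_at[of "i ` F" "i v" W] embed_CB[OF assms] i_mem
      by (simp add: CB_def radius_at_embed)
  qed
  show "rad V F \<le> rad W (i ` F)"
    unfolding rad_def[of W]
  proof (rule cINF_greatest)
    show "W \<noteq> {}"
      using V_nonempty i_mem by blast
    fix w assume "w \<in> W"
    then have "rad V F \<le> radius_at (p w) F"
      using assms by (intro rad_le_radius_at) (auto simp: CB_def p_mem)
    then show "rad V F \<le> radius_at w (i ` F)"
      using radius_at_retract_le[OF assms, of w] by linarith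
  qed
qed

text \<open>The radius at \<open>p c\<close> is at most the radius at \<open>c\<close>, which is the
  common restricted radius, and no point of \<open>V\<close> does better.\<close>

lemma retract_cent:
  assumes F: "F \<in> CB" and c: "c \<in> cent W (i ` F)"
  shows "p c \<in> cent V F"
proof -
  have "p c \<in> V"
    using c p_mem by (simp add: cent_def)
  moreover have "radius_at (p c) F \<le> rad V F"
    using radius_at_retract_le[OF F, of c] c rad_embed[OF F] by (simp add: cent_def)
  ultimately show ?thesis
    using rad_le_radius_at[of F "p c" V] F by (simp add: cent_def CB_def)
qed

lemma embed_near_cent:
  assumes "F \<in> CB" "v \<in> near_cent V F \<delta>"
  shows "i v \<in> near_cent W (i ` F) \<delta>"
  using assms by (simp add: near_cent_def i_mem radius_at_embed rad_embed)

lemma restricted_center_property_retract: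
  assumes "restricted_center_property W CB"
  shows "restricted_center_property V CB"
  using assms embed_CB retract_cent unfolding restricted_center_property_def by fast

text \<open>For given \<open>\<epsilon>\<close>, the \<open>\<delta>\<close> that works for the
  embedded copy of \<open>F\<close> also works for \<open>F\<close>.\<close>

lemma property_P1_retract:
  assumes P1: "property_P1 W CB"
  shows "property_P1 V CB"
  unfolding property_P1_def
proof (intro conjI allI impI ballI)
  show "restricted_center_property V CB"
    using P1 by (simp add: property_P1_def restricted_center_property_retract)
  fix \<epsilon> :: real and F :: "'a set"
  assume "\<epsilon> > 0" and F: "F \<in> CB"
  then obtain \<delta> where "\<delta> > 0" and \<delta>: "near_cent W (i ` F) \<delta> \<subseteq>
      {c + \<epsilon> *\<^sub>R b |c b. c \<in> cent W (i ` F) \<and> b \<in> cball 0 1}"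
    using P1 embed_CB unfolding property_P1_def by meson
  have "v \<in> {c + \<epsilon> *\<^sub>R b |c b. c \<in> cent V F \<and> b \<in> cball 0 1}" if near: "v \<in> near_cent V F \<delta>" for v
  proof -
    obtain c b where c: "c \<in> cent W (i ` F)" and b: "norm b \<le> 1" and v: "i v = c + \<epsilon> *\<^sub>R b"
      using \<delta> embed_near_cent[OF F near] by auto
    \<comment> \<open>Applying \<open>p\<close> to the decomposition of \<open>i v\<close> gives one
      of \<open>v\<close>, with a center of \<open>F\<close> and a vector of the unit ball.\<close>
    have "v = p c + \<epsilon> *\<^sub>R p b"
      by (metis v p_i linear_add linear_p linear_scale)
    moreover have "p b \<in> cball 0 1"
      using norm_p[of b] b by simp
    ultimately show ?thesis
      using retract_cent[OF F c] by blast
  qed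
  then show "\<exists>\<delta>>0. near_cent V F \<delta> \<subseteq> {c + \<epsilon> *\<^sub>R b |c b. c \<in> cent V F \<and> b \<in> cball 0 1}"
    using \<open>\<delta> > 0\<close> by blast
qed

end

theorem proposition3p6:
  fixes Y1 :: "'a::banach set" and Y2 :: "'b::banach set"
  assumes "subspace Y1" "closed Y1" "Y1 \<noteq> {0}"
    and "subspace Y2" "closed Y2" "Y2 \<noteq> {0}"
  shows "(restricted_center_property (linf_Times Y1 Y2) (CB :: ('a, 'b) linf_sum set set) \<longrightarrow>
           restricted_center_property Y1 (CB :: 'a set set) \<and>
           restricted_center_property Y2 (CB :: 'b set set)) \<and>
         (property_P1 (linf_Times Y1 Y2) (CB :: ('a, 'b) linf_sum set set) \<longrightarrow>
           property_P1 Y1 (CB :: 'a set set) \<and>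
           property_P1 Y2 (CB :: 'b set set))"
proof -
  have zero: "0 \<in> Y1" "0 \<in> Y2"
    using assms by (auto simp: subspace_0)
  \<comment> \<open>\<open>Linf x 0\<close> stays in the product because 0 lies in
    \<open>Y2\<close>; padding with 0 leaves the maximum norm unchanged, and a coordinate never
    exceeds the maximum.\<close>
  interpret first: norm_one_retract "\<lambda>x. Linf x 0" linf_fst Y1 "linf_Times Y1 Y2"
    by unfold_locales
      (use zero in \<open>auto simp: linf_Times_def norm_linf_sum_def plus_linf_sum_def
        scaleR_linf_sum_def\<close>)
  interpret second: norm_one_retract "\<lambda>x. Linf 0 x" linf_snd Y2 "linf_Times Y1 Y2"
    by unfold_locales
      (use zero in \<open>auto simp: linf_Times_def norm_linf_sum_def plus_linf_sum_def
        scaleR_linf_sum_def\<close>)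
  show ?thesis
    using first.restricted_center_property_retract second.restricted_center_property_retract
      first.property_P1_retract second.property_P1_retract by blast
qed

end
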